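(* Let $p,q>0$ be real numbers with $\frac1p+\frac1q=1$ and let $X_1,X_2$ be separable reflexive Banach spaces. Let $(\psi_k)\subseteq X_1^*$ be a $p$-Bessel sequence for $X_1$ and $(\phi_k)\subseteq X_2$ a $q$-Bessel sequence for $X_2^*$. For each $l\in\mathbb{N}$ let $(\psi_k^{(l)})_k\subseteq X_1^*$ be a $p$-Bessel sequence for $X_1$ and $(\phi_k^{(l)})_k\subseteq X_2$ a $q$-Bessel sequence for $X_2^*$. Let $p_1,q_1\ge1$ with $\frac1{p_1}+\frac1{q_1}=1$, where the values $p_1=\infty$ or $q_1=\infty$ are allowed. For a bounded scalar sequence $m$ write $\mathbf{M}_{m,(\phi_k),(\psi_k)}(f)=\sum_k m_k\,\psi_k(f)\,\phi_k$, and similarly for the other sequences. Then: (1) If $m^{(l)}\to m$ in $\ell^{p_1}$, then $\|\mathbf{M}_{m^{(l)},(\phi_k),(\psi_k)}-\mathbf{M}_{m,(\phi_k),(\psi_k)}\|_{Op}\to0$ as $l\to\infty$. (2) If $m\in\ell^{p_1}$ and the sequences $(\psi_k^{(l)})$ converge to $(\psi_k)$ in an $\ell^{q_1}$-sense, then $\|\mathbf{M}_{m,(\phi_k),(\psi_k^{(l)})}-\mathbf{M}_{m,(\phi_k),(\psi_k)}\|_{Op}\to0$ as $l\to\infty$. (3) If $m\in\ell^{p_1}$ and the sequences $(\phi_k^{(l)})$ converge to $(\phi_k)$ in an $\ell^{q_1}$-sense, then $\|\mathbf{M}_{m,(\phi_k^{(l)}),(\psi_k)}-\mathbf{M}_{m,(\phi_k),(\psi_k)}\|_{Op}\to0$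 as $l\to\infty$. (4) If $m^{(l)}\to m$ in $\ell^{p_1}$ and the sequences $(\psi_k^{(l)})$ and $(\phi_k^{(l)})$ converge to $(\psi_k)$ and $(\phi_k)$, respectively, in an $\ell^{q_1}$-sense, then $\|\mathbf{M}_{m^{(l)},(\phi_k^{(l)}),(\psi_k^{(l)})}-\mathbf{M}_{m,(\phi_k),(\psi_k)}\|_{Op}\to0$ as $l\to\infty$.
   Context: All sequences in $k$ are indexed by the same countable set. A countable family $(g_i)\subseteq X^*$ is a $p$-Bessel sequence for a Banach space $X$ ($1<p<\infty$) if there is $B>0$ (a bound) with $\left(\sum_i|g_i(f)|^p\right)^{1/p}\le B\|f\|_X$ for all $f\in X$. A family $(\phi_k)\subseteq X_2$ is a $q$-Bessel sequence for $X_2^*$ with bound $B_2$ (identifying $X_2=X_2^{**}$) if $\left(\sum_k|h(\phi_k)|^q\right)^{1/q}\le B_2\|h\|$ for all $h\in X_2^*$. For such sequences and $m\in\ell^\infty$ the series defining $\mathbf{M}_{m,(\phi_k),(\psi_k)}(f)$ converges unconditionally and defines a bounded operator $X_1\to X_2$. Sequences $(\xi_k^{(l)})_k$, $l\in\mathbb{N}$, in a Banach space $Y$ converge to $(\xi_k)_k\subseteq Y$ in an $\ell^{s}$-sense ($1\le s\le\infty$) if for every $\varepsilon>0$ there is $N_\varepsilon$ such that $\left(\sum_k\|\xi_k^{(l)}-\xi_k\|_Y^{s}\right)^{1/s}<\varepsilon$ for all $l\ge N_\varepsilon$ (with $\sup_k\|\xi_k^{(l)}-\xi_k\|_Y$ in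 place of the sum if $s=\infty$). "$m^{(l)}\to m$ in $\ell^{p_1}$" means $m^{(l)},m\in\ell^{p_1}$ and $\|m^{(l)}-m\|_{p_1}\to0$. $\|\cdot\|_{Op}$ is the operator norm. *)

theory Defs
  imports "HOL-Analysis.Analysis"
begin

(* Scalar fields. The norm is multiplicative and extends the absolute value of the reals, so the
   instances are, up to isometric isomorphism, exactly the reals and the complex numbers. *)
class real_or_complex = real_normed_field +
  assumes real_or_complex:
    "(\<forall>z. \<exists>a. z = a *\<^sub>R 1) \<or>
     (\<exists>i. i * i = - 1 \<and> (\<forall>z. \<exists>a b. z = a *\<^sub>R 1 + b *\<^sub>R i))"

instance real :: real_or_complex
  by standard simp

instance complex :: real_or_complex
proof
  have "z = Re z *\<^sub>R 1 + Im z *\<^sub>R \<i>" for z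
    by (simp add: complex_eq_iff)
  then show "(\<forall>z::complex. \<exists>a. z = a *\<^sub>R 1) \<or>
     (\<exists>i::complex. i * i = - 1 \<and> (\<forall>z. \<exists>a b. z = a *\<^sub>R 1 + b *\<^sub>R i))"
    using i_squared by blast
qed

(* Banach spaces over 'k. The class banach provides a complete norm on a real vector space; smul is
   the multiplication by elements of 'k. *)
locale banach_over = vector_space smul
  for smul :: "'k::real_or_complex \<Rightarrow> 'a::banach \<Rightarrow> 'a" +
  assumes norm_smul: "norm (smul c x) = norm c * norm x"
    and smul_of_real: "smul (of_real r) x = r *\<^sub>R x"

lemma banach_over_scaleR: "banach_over ((*\<^sub>R) :: real \<Rightarrow> 'a::banach \<Rightarrow> 'a)"
  by unfold_locales (auto simp: scaleR_add_right scaleR_add_left)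

lemma banach_over_mult: "banach_over ((*) :: complex \<Rightarrow> complex \<Rightarrow> complex)"
  by unfold_locales (auto simp: algebra_simps norm_mult scaleR_conv_of_real)

(* The dual space: the bounded functionals that are 'k-linear. The type 'a \<Rightarrow>\<^sub>L 'k only
   requires real linearity; its norm is the operator norm. *)
definition dual_space :: "('k::real_or_complex \<Rightarrow> 'a::banach \<Rightarrow> 'a) \<Rightarrow> ('a \<Rightarrow>\<^sub>L 'k) set" where
  "dual_space smul =
     {g. \<forall>c x. blinfun_apply g (smul c x) = c * blinfun_apply g x}"

(* The bidual: bounded 'k-linear functionals on the dual. Values outside dual_space are irrelevant.
   blinfun_mult_right c o\<^sub>L g is the functional c g. *)
definition bidual_space ::
    "('k::real_or_complex \<Rightarrow> 'a::banach \<Rightarrow> 'a) \<Rightarrow> (('a \<Rightarrow>\<^sub>L 'k) \<Rightarrow> 'k) set" where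
  "bidual_space smul =
     {F. (\<forall>g\<in>dual_space smul. \<forall>h\<in>dual_space smul. F (g + h) = F g + F h) \<and>
         (\<forall>c. \<forall>g\<in>dual_space smul. F (blinfun_mult_right c o\<^sub>L g) = c * F g) \<and>
         (\<exists>C. \<forall>g\<in>dual_space smul. norm (F g) \<le> C * norm g)}"

definition reflexive_space :: "('k::real_or_complex \<Rightarrow> 'a::banach \<Rightarrow> 'a) \<Rightarrow> bool" where
  "reflexive_space smul \<longleftrightarrow>
     (\<forall>F\<in>bidual_space smul. \<exists>x. \<forall>g\<in>dual_space smul. F g = blinfun_apply g x)"

(* g is a family in the dual, indexed by I, that is p-Bessel for the space.
   infsum is 0 for divergent families, hence the explicit summability. *)
definition bessel_seq ::
    "('k::real_or_complex \<Rightarrow> 'a::banach \<Rightarrow> 'a) \<Rightarrow> real \<Rightarrow> 'i set \<Rightarrow> ('i \<Rightarrow> 'a \<Rightarrow>\<^sub>L 'k) \<Rightarrow> bool" where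
  "bessel_seq smul p I g \<longleftrightarrow>
     (\<forall>k\<in>I. g k \<in> dual_space smul) \<and>
     (\<exists>B>0. \<forall>f. (\<lambda>k. norm (blinfun_apply (g k) f) powr p) summable_on I \<and>
        (\<Sum>\<^sub>\<infinity>k\<in>I. norm (blinfun_apply (g k) f) powr p) powr (1 / p) \<le> B * norm f)"

(* \<phi> is a family in the space itself, regarded via evaluation as a q-Bessel sequence for the dual. *)
definition bessel_seq_dual ::
    "('k::real_or_complex \<Rightarrow> 'a::banach \<Rightarrow> 'a) \<Rightarrow> real \<Rightarrow> 'i set \<Rightarrow> ('i \<Rightarrow> 'a) \<Rightarrow> bool" where
  "bessel_seq_dual smul q I \<phi> \<longleftrightarrow>
     (\<exists>B>0. \<forall>h\<in>dual_space smul. (\<lambda>k. norm (blinfun_apply h (\<phi> k)) powr q) summable_on I \<and>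
        (\<Sum>\<^sub>\<infinity>k\<in>I. norm (blinfun_apply h (\<phi> k)) powr q) powr (1 / q) \<le> B * norm h)"

(* infsum is unordered summation, i.e. unconditional convergence. *)
definition multiplier ::
    "('k::real_or_complex \<Rightarrow> 'b::banach \<Rightarrow> 'b) \<Rightarrow> 'i set \<Rightarrow> ('i \<Rightarrow> 'k) \<Rightarrow> ('i \<Rightarrow> 'b) \<Rightarrow>
     ('i \<Rightarrow> 'a::banach \<Rightarrow>\<^sub>L 'k) \<Rightarrow> 'a \<Rightarrow> 'b" where
  "multiplier smul I m \<phi> \<psi> f =
     (\<Sum>\<^sub>\<infinity>k\<in>I. smul (m k * blinfun_apply (\<psi> k) f) (\<phi> k))"

definition in_ell :: "ereal \<Rightarrow> 'i set \<Rightarrow> ('i \<Rightarrow> 'b::real_normed_vector) \<Rightarrow> bool" where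
  "in_ell s I x \<longleftrightarrow>
     (if s = \<infinity> then bdd_above ((\<lambda>k. norm (x k)) ` I)
      else (\<lambda>k. norm (x k) powr real_of_ereal s) summable_on I)"

(* Inserting 0 into the supremum only matters for empty I. *)
definition ell_norm :: "ereal \<Rightarrow> 'i set \<Rightarrow> ('i \<Rightarrow> 'b::real_normed_vector) \<Rightarrow> real" where
  "ell_norm s I x =
     (if s = \<infinity> then Sup (insert 0 ((\<lambda>k. norm (x k)) ` I))
      else (\<Sum>\<^sub>\<infinity>k\<in>I. norm (x k) powr real_of_ereal s) powr (1 / real_of_ereal s))"

definition converges_in_ell ::
    "ereal \<Rightarrow> 'i set \<Rightarrow> (nat \<Rightarrow> 'i \<Rightarrow> 'k::real_normed_vector) \<Rightarrow> ('i \<Rightarrow> 'k) \<Rightarrow> bool" where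
  "converges_in_ell s I ml m \<longleftrightarrow>
     (\<forall>l. in_ell s I (ml l)) \<and> in_ell s I m \<and>
     (\<lambda>l. ell_norm s I (\<lambda>k. ml l k - m k)) \<longlonglongrightarrow> 0"

(* The sequences themselves need not lie in \<ell>\<^sup>s, only the differences. *)
definition converges_in_ell_sense ::
    "ereal \<Rightarrow> 'i set \<Rightarrow> (nat \<Rightarrow> 'i \<Rightarrow> 'b::real_normed_vector) \<Rightarrow> ('i \<Rightarrow> 'b) \<Rightarrow> bool" where
  "converges_in_ell_sense s I \<xi>l \<xi> \<longleftrightarrow>
     (\<forall>\<epsilon>>0. \<exists>N. \<forall>l\<ge>N. in_ell s I (\<lambda>k. \<xi>l l k - \<xi> k) \<and>
        ell_norm s I (\<lambda>k. \<xi>l l k - \<xi> k) < \<epsilon>)"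

end

theory Submission
  imports Defs
begin

text \<open>
A Bessel multiplier depends trilinearly on its symbol, its synthesis family and its analysis
family, and two kinds of estimate control its operator norm.

If both families are Bessel, then the multiplier is bounded by \<open>\<parallel>m\<parallel>\<^sub>\<infinity> B1 B2\<close>: the coefficients
\<open>m\<^sub>k \<psi>\<^sub>k(f)\<close> form an element of \<open>\<ell>\<^sup>p\<close>, and a \<open>q\<close>-Bessel family \<open>\<phi>\<close> can be synthesised with any
coefficients in \<open>\<ell>\<^sup>p\<close>. The latter is the dual form of the Bessel inequality, and passing from the
scalars \<open>h(y)\<close> to the norm of a partial sum \<open>y\<close> is where the Hahn-Banach theorem enters
(\<open>dual_space_norming\<close>, \<open>norm_synthesis_le\<close>). As \<open>\<parallel>m\<parallel>\<^sub>\<infinity> \<le> \<parallel>m\<parallel>\<^bsub>p1\<^esub>\<close>, the bound is usable for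
every exponent of the symbol.

If instead the symbol lies in \<open>\<ell>\<close> with exponent \<open>p1\<close>, one family lies in \<open>\<ell>\<close> with the conjugate
exponent \<open>q1\<close>, and the other is merely bounded in norm, then the series converges absolutely and
Hoelder's inequality for \<open>p1\<close> and \<open>q1\<close> bounds it. Bessel families are bounded in norm by their
Bessel bounds.

With \<open>\<mu> = m' - m\<close>, \<open>\<eta> = \<psi>' - \<psi>\<close> and \<open>\<delta> = \<phi>' - \<phi>\<close>, the summands of two multipliers differ by
\<open>\<mu>\<^sub>k \<psi>\<^sub>k(f) \<phi>\<^sub>k + m'\<^sub>k \<eta>\<^sub>k(f) \<phi>\<^sub>k + m'\<^sub>k \<psi>'\<^sub>k(f) \<delta>\<^sub>k\<close>.
The first term is governed by the first estimate, the other two by the second, with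
\<open>\<parallel>\<psi>'\<^sub>k\<parallel> \<le> B1 + \<parallel>\<eta>\<parallel>\<^bsub>q1\<^esub>\<close> in the last one. The Bessel bounds that occur belong to the limit
families, so they do not depend on the index of the approximation, and the estimate tends to zero
when all three sequences converge (\<open>norm_multiplier_diff_le\<close>). The claims in which only one of
the sequences varies are the cases in which the other two are constant.
\<close>

section \<open>The Hahn-Banach theorem\<close>

text \<open>The homogeneity axiom is an inequality because that is all one has to check for an infimum of
sublinear functionals; applying it to the inverse scalar gives equality.\<close>

definition sublinear :: "('a::real_vector \<Rightarrow> real) \<Rightarrow> bool" where
  "sublinear f \<longleftrightarrow>
     (\<forall>x y. f (x + y) \<le> f x + f y) \<and> (\<forall>c x. 0 \<le> c \<longrightarrow> f (c *\<^sub>R x) \<le> c * f x)"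

lemma sublinear_add: "sublinear f \<Longrightarrow> f (x + y) \<le> f x + f y"
  by (simp add: sublinear_def)

lemma sublinear_scaleR_le: "sublinear f \<Longrightarrow> 0 \<le> c \<Longrightarrow> f (c *\<^sub>R x) \<le> c * f x"
  by (simp add: sublinear_def)

lemma sublinear_zero: 
  assumes "sublinear f"
  shows "f 0 = 0"
  using sublinear_add[OF assms, of 0 0] sublinear_scaleR_le[OF assms, of 0 0] by simp

lemma sublinear_scaleR:
  assumes f: "sublinear f" and c: "0 \<le> c"
  shows "f (c *\<^sub>R x) = c * f x"
proof (cases "c = 0")
  case True
  then show ?thesis by (simp add: sublinear_zero[OF f])
next
  case False
  then have "0 < c" using c by simp
  have "f x \<le> inverse c * f (c *\<^sub>R x)"
    using sublinear_scaleR_le[OF f, of "inverse c" "c *\<^sub>R x"] \<open>0 < c\<close> by simp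
  then have "c * f x \<le> f (c *\<^sub>R x)"
    using \<open>0 < c\<close> by (simp add: field_simps)
  then show ?thesis using sublinear_scaleR_le[OF f c, of x] by simp
qed

lemma sublinear_ge_neg:
  assumes "sublinear f"
  shows "- f (- x) \<le> f x"
  using sublinear_add[OF assms, of x "- x"] sublinear_zero[OF assms] by simp

lemma sublinear_norm: "sublinear (norm :: 'a::real_normed_vector \<Rightarrow> real)"
  by (simp add: sublinear_def norm_triangle_ineq)

text \<open>The reduction step of the Hahn-Banach theorem: among the sublinear functionals below a
sublinear \<open>f\<close>, this
one has the smallest value at \<open>- y\<close>, namely \<open>- f y\<close>. It is finite because sublinearity of \<open>f\<close>
bounds every term of the infimum from below by \<open>- f (- x)\<close>.\<close>

definition lowered :: "('a::real_vector \<Rightarrow> real) \<Rightarrow> 'a \<Rightarrow> 'a \<Rightarrow> real" where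
  "lowered f y x = (INF t\<in>{0..}. f (x + t *\<^sub>R y) - t * f y)"

lemma
  assumes f: "sublinear f"
  shows lowered_le_at: "0 \<le> t \<Longrightarrow> lowered f y x \<le> f (x + t *\<^sub>R y) - t * f y"
    and sublinear_lowered: "sublinear (lowered f y)"
proof -
  have lb: "- f (- x) \<le> f (x + t *\<^sub>R y) - t * f y" if "0 \<le> t" for x t
    using sublinear_add[OF f, of "x + t *\<^sub>R y" "- x"] sublinear_scaleR[OF f that, of y] by simp
  have bdd: "bdd_below ((\<lambda>t. f (x + t *\<^sub>R y) - t * f y) ` {0..})" for x
    using lb by (intro bdd_belowI2[where m = "- f (- x)"]) auto
  have le: "lowered f y x \<le> f (x + t *\<^sub>R y) - t * f y" if "0 \<le> t" for x t
    unfolding lowered_def using that by (intro cINF_lower bdd) auto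
  have greatest: "z \<le> lowered f y x" if "\<And>t. 0 \<le> t \<Longrightarrow> z \<le> f (x + t *\<^sub>R y) - t * f y" for x z
    unfolding lowered_def using that by (intro cINF_greatest) auto
  show "0 \<le> t \<Longrightarrow> lowered f y x \<le> f (x + t *\<^sub>R y) - t * f y" by (rule le)
  have sub: "lowered f y (u + v) \<le> lowered f y u + lowered f y v" for u v
  proof -
    have *: "lowered f y (u + v) - (f (u + s *\<^sub>R y) - s * f y) \<le> f (v + t *\<^sub>R y) - t * f y"
      if "0 \<le> s" "0 \<le> t" for s t
      using le[of "s + t" "u + v"] sublinear_add[OF f, of "u + s *\<^sub>R y" "v + t *\<^sub>R y"] that
      by (simp add: algebra_simps)
    have "lowered f y (u + v) - (f (u + s *\<^sub>R y) - s * f y) \<le> lowered f y v" if "0 \<le> s" for s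
      by (rule greatest) (rule *[OF that])
    then have "lowered f y (u + v) - lowered f y v \<le> lowered f y u"
      by (intro greatest) (simp add: algebra_simps)
    then show ?thesis by simp
  qed
  have hom: "lowered f y (c *\<^sub>R x) \<le> c * lowered f y x" if "0 \<le> c" for c x
  proof (cases "c = 0")
    case True
    then show ?thesis using le[of 0 0] sublinear_zero[OF f] by simp
  next
    case False
    then have c: "0 < c" using that by simp
    have "lowered f y (c *\<^sub>R x) / c \<le> f (x + t *\<^sub>R y) - t * f y" if t: "0 \<le> t" for t
    proof -
      have "lowered f y (c *\<^sub>R x) \<le> f (c *\<^sub>R x + (c * t) *\<^sub>R y) - (c * t) * f y"
        using c t by (intro le) simp
      also have "c *\<^sub>R x + (c * t) *\<^sub>R y = c *\<^sub>R (x + t *\<^sub>R y)"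
        by (simp add: algebra_simps)
      also have "f (c *\<^sub>R (x + t *\<^sub>R y)) - (c * t) * f y = c * (f (x + t *\<^sub>R y) - t * f y)"
        using sublinear_scaleR[OF f, of c "x + t *\<^sub>R y"] c by (simp add: right_diff_distrib)
      finally show ?thesis using c by (simp add: field_simps)
    qed
    then have "lowered f y (c *\<^sub>R x) / c \<le> lowered f y x" by (rule greatest)
    then show ?thesis using c by (simp add: field_simps)
  qed
  show "sublinear (lowered f y)" unfolding sublinear_def using sub hom by blast
qed

lemma lowered_le: "sublinear f \<Longrightarrow> lowered f y x \<le> f x"
  using lowered_le_at[of f 0 y x] by simp

text \<open>Lowering a minimal functional in any direction \<open>y\<close> changes nothing, and the term \<open>t = 1\<close> of the
infimum then says that \<open>f\<close> is superadditive.\<close>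

lemma linear_if_minimal_sublinear:
  assumes f: "sublinear f"
    and minimal: "\<And>g. sublinear g \<Longrightarrow> (\<And>x. g x \<le> f x) \<Longrightarrow> g = f"
  shows "linear f"
proof -
  have "lowered f y = f" for y
    by (intro minimal sublinear_lowered lowered_le f)
  then have "f x + f y \<le> f (x + y)" for x y
    using lowered_le_at[OF f, of 1 y x] by simp
  then have add: "f (x + y) = f x + f y" for x y
    using sublinear_add[OF f, of x y] by (simp add: order_antisym)
  have neg: "f (- x) = - f x" for x
    using add[of x "- x"] sublinear_zero[OF f] by simp
  have "f (c *\<^sub>R x) = c * f x" for c x
    using sublinear_scaleR[OF f, of c x] sublinear_scaleR[OF f, of "- c" x] neg[of "c *\<^sub>R x"]
    by (cases "0 \<le> c") simp_all
  then show ?thesis using add by (intro linearI) simp_all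
qed

text \<open>Zorn's lemma gives a minimal sublinear functional below \<open>p\<close>. The infimum over a chain is sublinear
because any two members of the chain can be compared, so that one of them serves both summands.\<close>

theorem Hahn_Banach_sublinear:
  assumes p: "sublinear p"
  shows "\<exists>f. linear f \<and> (\<forall>x. f x \<le> p x)"
proof -
  define A where "A = {f. sublinear f \<and> (\<forall>x. f x \<le> p x)}"
  \<comment> \<open>Zorn's lemma produces maximal elements, hence the reversed order.\<close>
  define R where "R f g \<longleftrightarrow> (\<forall>x. g x \<le> f x)" for f g :: "'a \<Rightarrow> real"
  have "\<exists>m\<in>A. \<forall>g\<in>A. R m g \<longrightarrow> g = m"
  proof (rule predicate_Zorn)
    show "partial_order_on A (relation_of R A)"
      by (rule partial_order_on_relation_ofI) (auto simp: R_def fun_eq_iff intro: order_trans order_antisym)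
  next
    fix C assume C: "C \<in> Chains (relation_of R A)"
    then have CA: "C \<subseteq> A" and tot: "\<And>f g. f \<in> C \<Longrightarrow> g \<in> C \<Longrightarrow> R f g \<or> R g f"
      by (auto simp: Chains_def relation_of_def)
    show "\<exists>u\<in>A. \<forall>f\<in>C. R f u"
    proof (cases "C = {}")
      case True
      then show ?thesis using p by (auto simp: A_def)
    next
      case False
      define u where "u x = (INF f\<in>C. f x)" for x
      have lb: "- p (- x) \<le> f x" if "f \<in> C" for f x
      proof -
        have "f \<in> A" using CA that by blast
        then have f: "sublinear f" and "f (- x) \<le> p (- x)" by (auto simp: A_def)
        then show ?thesis using sublinear_ge_neg[OF f, of x] by linarith
      qed
      have u_le: "u x \<le> f x" if "f \<in> C" for f x
        unfolding u_def using lb that by (intro cINF_lower bdd_belowI2) auto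
      have u_greatest: "z \<le> u x" if "\<And>f. f \<in> C \<Longrightarrow> z \<le> f x" for x z
        unfolding u_def using that False by (intro cINF_greatest) auto
      have sub: "u (x + y) \<le> u x + u y" for x y
      proof -
        have *: "u (x + y) - f x \<le> g y" if fg: "f \<in> C" "g \<in> C" for f g
        proof -
          obtain h where h: "h \<in> C" "h x \<le> f x" "h y \<le> g y"
            using tot[OF fg] fg unfolding R_def by blast
          then have "sublinear h" using CA by (auto simp: A_def)
          then have "u (x + y) \<le> h x + h y"
            using u_le[OF h(1), of "x + y"] sublinear_add[of h x y] by linarith
          then show ?thesis using h by linarith
        qed
        have "u (x + y) - f x \<le> u y" if "f \<in> C" for f
          by (rule u_greatest) (rule *[OF that])
        then have "u (x + y) - u y \<le> u x" by (intro u_greatest) (simp add: algebra_simps)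
        then show ?thesis by simp
      qed
      have hom: "u (c *\<^sub>R x) \<le> c * u x" if c: "0 \<le> c" for c x
      proof (cases "c = 0")
        case True
        obtain f where "f \<in> C" using False by blast
        moreover from this have "f 0 = 0" using CA sublinear_zero by (auto simp: A_def)
        ultimately show ?thesis using True u_le[of f 0] by simp
      next
        case False
        then have "0 < c" using c by simp
        have "u (c *\<^sub>R x) / c \<le> f x" if "f \<in> C" for f
        proof -
          have "u (c *\<^sub>R x) \<le> f (c *\<^sub>R x)" using that by (rule u_le)
          also have "\<dots> = c * f x" using CA that c by (auto simp: A_def sublinear_scaleR)
          finally show ?thesis using \<open>0 < c\<close> by (simp add: field_simps)
        qed
        then have "u (c *\<^sub>R x) / c \<le> u x" by (rule u_greatest)
        then show ?thesis using \<open>0 < c\<close> by (simp add: field_simps)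
      qed
      obtain f where "f \<in> C" using False by blast
      then have "u x \<le> p x" for x
        using CA u_le[of f x] by (auto simp: A_def intro: order_trans)
      then have "u \<in> A" using sub hom by (auto simp: A_def sublinear_def)
      then show ?thesis using u_le by (auto simp: R_def)
    qed
  qed
  then obtain m where m: "m \<in> A" and min: "\<And>g. g \<in> A \<Longrightarrow> R m g \<Longrightarrow> g = m" by blast
  have "linear m"
  proof (rule linear_if_minimal_sublinear)
    show "sublinear m" using m by (simp add: A_def)
    show "g = m" if "sublinear g" "\<And>x. g x \<le> m x" for g
      using m that by (intro min) (auto simp: A_def R_def intro: order_trans)
  qed
  then show ?thesis using m by (auto simp: A_def)
qed

text \<open>Lowering the norm in the direction \<open>x\<close> beforehand forces the linear functional below it to satisfy
\<open>f (- x) \<le> - norm x\<close>. This replaces the usual extension from the line through \<open>x\<close>.\<close>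

corollary Hahn_Banach_norming_real:
  fixes x :: "'a::real_normed_vector"
  shows "\<exists>f. linear f \<and> (\<forall>y. \<bar>f y\<bar> \<le> norm y) \<and> f x = norm x"
proof -
  obtain f where lin: "linear f" and f: "\<And>y. f y \<le> lowered norm x y"
    using Hahn_Banach_sublinear[OF sublinear_lowered[OF sublinear_norm]] by blast
  have le: "f y \<le> norm y" for y
    using f[of y] lowered_le[OF sublinear_norm, of x y] by linarith
  have "f (- x) \<le> - norm x"
    using f[of "- x"] lowered_le_at[OF sublinear_norm, of 1 x "- x"] by simp
  then have "f x = norm x" using le[of x] linear_neg[OF lin, of x] by simp
  moreover have "\<bar>f y\<bar> \<le> norm y" for y
    using le[of y] le[of "- y"] linear_neg[OF lin, of y] by simp
  ultimately show ?thesis using lin by blast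
qed

text \<open>A multiplicative norm on a copy of the complex numbers is the modulus. It is at most twice the
modulus by the triangle inequality; the factor disappears when the estimate is applied to \<open>w ^ n\<close>
and \<open>n\<close> tends to infinity. The reverse estimate follows by multiplicativity from the one for the
conjugate. Comparing real parts gives the claim.\<close>

lemma abs_le_norm_if_square_minus_one:
  fixes i :: "'k::real_normed_field"
  assumes i: "i * i = - 1"
  shows "\<bar>a\<bar> \<le> norm (a *\<^sub>R 1 + b *\<^sub>R i)"
proof -
  define N where "N w = norm (Re w *\<^sub>R 1 + Im w *\<^sub>R i)" for w
  have mult: "N (v * w) = N v * N w" for v w
  proof -
    have "Re (v * w) *\<^sub>R 1 + Im (v * w) *\<^sub>R i = (Re v *\<^sub>R 1 + Im v *\<^sub>R i) * (Re w *\<^sub>R 1 + Im w *\<^sub>R i)"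
      by (simp add: algebra_simps i)
    then show ?thesis by (simp add: N_def norm_mult)
  qed
  have pow: "N (w ^ n) = N w ^ n" for w n
    by (induction n) (simp_all add: mult, simp add: N_def)
  have "norm i * norm i = 1" using i by (metis norm_mult norm_minus_cancel norm_one)
  then have "norm i = 1"
    by (metis norm_ge_zero real_sqrt_mult_self real_sqrt_one abs_of_nonneg real_sqrt_abs2)
  then have two: "N w \<le> 2 * cmod w" for w
    using norm_triangle_ineq[of "Re w *\<^sub>R 1" "Im w *\<^sub>R i"] abs_Re_le_cmod[of w] abs_Im_le_cmod[of w]
    by (simp add: N_def)
  have le: "N w \<le> cmod w" for w
  proof (rule ccontr)
    assume *: "\<not> N w \<le> cmod w"
    then have w: "w \<noteq> 0" by (auto simp: N_def)
    then have "1 < N w / cmod w" using * by simp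
    then obtain n where "2 < (N w / cmod w) ^ n" using real_arch_pow by blast
    then have "2 * cmod w ^ n < N w ^ n" using w by (simp add: power_divide field_simps)
    then show False using two[of "w ^ n"] by (simp add: pow norm_power)
  qed
  define w where "w = Complex a b"
  have "N (of_real ((cmod w)\<^sup>2)) = (cmod w)\<^sup>2" by (simp add: N_def)
  then have "(cmod w)\<^sup>2 = N w * N (cnj w)" unfolding complex_norm_square mult by simp
  also have "\<dots> \<le> N w * cmod w" using le[of "cnj w"] by (simp add: mult_left_mono N_def)
  finally have "cmod w \<le> N w" by (cases "w = 0") (auto simp: power2_eq_square N_def)
  then show ?thesis using abs_Re_le_cmod[of w] by (simp add: N_def w_def)
qed

lemma independent_if_square_minus_one:
  fixes i :: "'k::real_normed_field"
  assumes "i * i = - 1" "a *\<^sub>R 1 + b *\<^sub>R i = c *\<^sub>R 1 + d *\<^sub>R i"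
  shows "a = c"
  using abs_le_norm_if_square_minus_one[OF assms(1), of "a - c" "b - d"] assms(2)
  by (simp add: algebra_simps)

text \<open>The passage from real to complex scalars: a real functional \<open>f\<close> is the real part of
\<open>g y = f y - f (i y) i\<close>, and rotating \<open>y\<close> by a unit scalar until \<open>g y\<close> is a nonnegative real shows
that \<open>g\<close> obeys the same norm bound as \<open>f\<close>.\<close>

theorem (in banach_over) dual_space_norming:
  "\<exists>h\<in>dual_space smul. norm h \<le> 1 \<and> norm (blinfun_apply h x) = norm x"
proof -
  obtain f where lin: "linear f" and f: "\<And>y. \<bar>f y\<bar> \<le> norm y" and fx: "f x = norm x"
    using Hahn_Banach_norming_real by blast
  have f_add: "f (y + z) = f y + f z" and f_diff: "f (y - z) = f y - f z"
    and f_scaleR: "f (r *\<^sub>R y) = r * f y" for y z r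
    using linear_add[OF lin] linear_diff[OF lin] linear_scale[OF lin] by simp_all
  have scaleR: "smul (r *\<^sub>R 1) y = r *\<^sub>R y" for r y
    using smul_of_real[of r y] by (simp add: of_real_def)
  have "\<exists>g. (\<forall>y z. g (y + z) = g y + g z) \<and> (\<forall>c y. g (smul c y) = c * g y) \<and>
          (\<forall>y. norm (g y) \<le> norm y) \<and> norm x \<le> norm (g x)"
  proof (cases "\<forall>z::'k. \<exists>a. z = a *\<^sub>R 1")
    case True
    have "f (smul c y) *\<^sub>R 1 = c * f y *\<^sub>R 1" for c y
    proof -
      obtain a where "c = a *\<^sub>R 1" using True by blast
      then show ?thesis by (simp add: scaleR f_scaleR)
    qed
    then show ?thesis
      by (intro exI[of _ "\<lambda>y. f y *\<^sub>R 1"]) (simp add: f f_add fx scaleR_add_left)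
  next
    case False
    then obtain i :: 'k where i: "i * i = - 1" and ex: "\<And>z. \<exists>a b. z = a *\<^sub>R 1 + b *\<^sub>R i"
      using real_or_complex by metis
    define g where "g y = f y *\<^sub>R 1 + (- f (smul i y)) *\<^sub>R i" for y
    have add: "g (y + z) = g y + g z" for y z
      by (simp add: g_def f_add scale_right_distrib algebra_simps)
    have hom: "g (smul c y) = c * g y" for c y
    proof -
      obtain a b where c: "c = a *\<^sub>R 1 + b *\<^sub>R i" using ex by blast
      have b: "smul (b *\<^sub>R i) z = b *\<^sub>R smul i z" for z
        using scale_scale[of "b *\<^sub>R 1" i z] scaleR[of b "smul i z"] by (simp del: scale_scale)
      have "smul i (b *\<^sub>R smul i y) = - (b *\<^sub>R y)"
        using scale_scale[of i "b *\<^sub>R i" y] i scaleR[of "- b" y] by (simp add: b)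
      moreover have "smul i (a *\<^sub>R y) = a *\<^sub>R smul i y"
        using scale_left_commute[of i "a *\<^sub>R 1" y] by (simp only: scaleR)
      ultimately show ?thesis
        by (simp add: g_def c scale_left_distrib scale_right_distrib scaleR b f_add f_diff f_scaleR
            algebra_simps i)
    qed
    have bound: "norm (g y) \<le> norm y" for y
    proof (cases "g y = 0")
      case False
      \<comment> \<open>the unit scalar that rotates \<open>g y\<close> to \<open>norm (g y)\<close>\<close>
      define c where "c = of_real (norm (g y)) / g y"
      have "norm c = 1" using False by (simp add: c_def norm_divide)
      have "g (smul c y) = of_real (norm (g y))" using False by (simp add: hom c_def)
      then have "g (smul c y) = norm (g y) *\<^sub>R 1 + 0 *\<^sub>R i" by (simp add: of_real_def)
      then have "f (smul c y) = norm (g y)"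
        unfolding g_def by (rule independent_if_square_minus_one[OF i])
      then show ?thesis using f[of "smul c y"] \<open>norm c = 1\<close> by (simp add: norm_smul)
    qed simp
    have "norm x \<le> norm (g x)"
      using abs_le_norm_if_square_minus_one[OF i, of "f x" "- f (smul i x)"] fx by (simp add: g_def)
    then show ?thesis using add hom bound by blast
  qed
  then obtain g where g: "\<And>y z. g (y + z) = g y + g z" "\<And>c y. g (smul c y) = c * g y"
      "\<And>y. norm (g y) \<le> norm y" "norm x \<le> norm (g x)" by blast
  have "g (r *\<^sub>R y) = r *\<^sub>R g y" for r y
    using g(2)[of "r *\<^sub>R 1" y] by (simp add: scaleR)
  then have bl: "bounded_linear g"
    using g(1,3) by (intro bounded_linear_intro[where K = 1]) simp_all
  then have app: "blinfun_apply (Blinfun g) = g" by (rule bounded_linear_Blinfun_apply)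
  show ?thesis
  proof
    show "Blinfun g \<in> dual_space smul" by (simp add: dual_space_def app g(2))
    show "norm (Blinfun g) \<le> 1 \<and> norm (blinfun_apply (Blinfun g) x) = norm x"
      using g(3,4) by (auto simp: app intro!: norm_blinfun_bound order_antisym)
  qed
qed

section \<open>Sequence spaces and Hoelder's inequality\<close>

lemma in_ell_ereal: "in_ell (ereal s) I x \<longleftrightarrow> (\<lambda>k. norm (x k) powr s) summable_on I"
  by (simp add: in_ell_def)

lemma ell_norm_ereal:
  "ell_norm (ereal s) I x = (\<Sum>\<^sub>\<infinity>k\<in>I. norm (x k) powr s) powr (1 / s)"
  by (simp add: ell_norm_def)

lemma in_ell_one: "in_ell 1 I x \<longleftrightarrow> (\<lambda>k. norm (x k)) summable_on I"
  by (simp add: in_ell_def)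

lemma ell_norm_one: "ell_norm 1 I x = (\<Sum>\<^sub>\<infinity>k\<in>I. norm (x k))"
  by (simp add: ell_norm_def infsum_nonneg)

lemma in_ell_zero: "in_ell s I (\<lambda>k. 0)"
  by (simp add: in_ell_def bdd_above_def) auto

lemma ell_norm_zero: "ell_norm s I (\<lambda>k. 0) = 0"
  by (simp add: ell_norm_def image_constant_conv)

lemma norm_le_ell_norm:
  assumes s: "1 \<le> s" and x: "in_ell s I x" and k: "k \<in> I"
  shows "norm (x k) \<le> ell_norm s I x"
proof (cases s)
  case (real r)
  then have r: "1 \<le> r" using s by simp
  have "norm (x k) powr r \<le> (\<Sum>\<^sub>\<infinity>j\<in>I. norm (x j) powr r)"
    using finite_sum_le_infsum[of "\<lambda>j. norm (x j) powr r" I "{k}"] x k real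
    by (simp add: in_ell_ereal)
  then have "(norm (x k) powr r) powr (1 / r) \<le> ell_norm s I x"
    using r real by (simp add: ell_norm_ereal powr_mono2)
  then show ?thesis using r by (simp add: powr_powr)
next
  case PInf
  then show ?thesis
    using x k unfolding ell_norm_def in_ell_def by (auto intro!: cSup_upper)
qed (use s in simp)

lemma ell_norm_nonneg:
  assumes "in_ell s I x"
  shows "0 \<le> ell_norm s I x"
proof (cases "s = \<infinity>")
  case True
  then show ?thesis using assms unfolding ell_norm_def in_ell_def by (auto intro!: cSup_upper)
qed (simp add: ell_norm_def)

lemma in_ell_subset: "in_ell s I x \<Longrightarrow> F \<subseteq> I \<Longrightarrow> in_ell s F x"
  unfolding in_ell_def
  by (auto intro: summable_on_subset_banach bdd_above_mono[OF _ image_mono] split: if_splits)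

lemma ell_norm_subset:
  assumes "in_ell (ereal s) I x" "F \<subseteq> I" "1 \<le> s"
  shows "ell_norm (ereal s) F x \<le> ell_norm (ereal s) I x"
  unfolding ell_norm_ereal
  using assms in_ell_subset[OF assms(1,2)]
  by (intro powr_mono2 infsum_mono2 infsum_nonneg) (auto simp: in_ell_ereal)

text \<open>Used to multiply a sequence in \<open>\<ell>\<^sup>p\<close> by a bounded symbol.\<close>

lemma
  assumes s: "1 \<le> s" and y: "in_ell (ereal s) I y" and C: "0 \<le> C"
    and le: "\<And>k. k \<in> I \<Longrightarrow> norm (x k) \<le> C * norm (y k)"
  shows in_ell_dominated: "in_ell (ereal s) I x"
    and ell_norm_dominated: "ell_norm (ereal s) I x \<le> C * ell_norm (ereal s) I y"
proof -
  have p: "norm (x k) powr s \<le> C powr s * norm (y k) powr s" if "k \<in> I" for k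
    using powr_mono2[OF _ _ le[OF that], of s] s C by (simp add: powr_mult)
  have sum: "(\<lambda>k. C powr s * norm (y k) powr s) summable_on I"
    using y by (intro summable_on_cmult_right) (simp add: in_ell_ereal)
  show x: "in_ell (ereal s) I x"
    unfolding in_ell_ereal using sum by (rule summable_on_comparison_test) (use p in auto)
  have "(\<Sum>\<^sub>\<infinity>k\<in>I. norm (x k) powr s) \<le> (\<Sum>\<^sub>\<infinity>k\<in>I. C powr s * norm (y k) powr s)"
    using x sum p by (intro infsum_mono) (auto simp: in_ell_ereal)
  also have "\<dots> = C powr s * (\<Sum>\<^sub>\<infinity>k\<in>I. norm (y k) powr s)" by (rule infsum_cmult_right')
  finally have "ell_norm (ereal s) I x
      \<le> (C powr s * (\<Sum>\<^sub>\<infinity>k\<in>I. norm (y k) powr s)) powr (1 / s)"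
    unfolding ell_norm_ereal using s by (intro powr_mono2 infsum_nonneg) auto
  also have "\<dots> = C * ell_norm (ereal s) I y"
    using s C by (simp add: powr_mult infsum_nonneg powr_powr ell_norm_ereal)
  finally show "ell_norm (ereal s) I x \<le> C * ell_norm (ereal s) I y" .
qed

lemma in_ell_diff:
  assumes s: "1 \<le> s" and x: "in_ell s I x" and y: "in_ell s I y"
  shows "in_ell s I (\<lambda>k. x k - y k)"
proof (cases s)
  case (real r)
  then have r: "1 \<le> r" using s by simp
  have le: "norm (x k - y k) powr r \<le> 2 powr r * norm (x k) powr r + 2 powr r * norm (y k) powr r" for k
  proof -
    have "norm (x k - y k) \<le> 2 * max (norm (x k)) (norm (y k))"
      using norm_triangle_ineq4[of "x k" "y k"] by simp
    then have "norm (x k - y k) powr r \<le> 2 powr r * max (norm (x k)) (norm (y k)) powr r"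
      using powr_mono2[of r "norm (x k - y k)" "2 * max (norm (x k)) (norm (y k))"] r
      by (simp add: powr_mult le_max_iff_disj)
    also have "\<dots> \<le> 2 powr r * (norm (x k) powr r + norm (y k) powr r)"
      by (intro mult_left_mono) (auto simp: max_def)
    finally show ?thesis by (simp add: distrib_left)
  qed
  have "(\<lambda>k. 2 powr r * norm (x k) powr r + 2 powr r * norm (y k) powr r) summable_on I"
    using x y real by (intro summable_on_add summable_on_cmult_right) (auto simp: in_ell_ereal)
  then show ?thesis
    unfolding real in_ell_ereal by (rule summable_on_comparison_test) (use le in auto)
next
  case PInf
  then obtain A B where "\<And>k. k \<in> I \<Longrightarrow> norm (x k) \<le> A" "\<And>k. k \<in> I \<Longrightarrow> norm (y k) \<le> B"
    using x y by (auto simp: in_ell_def bdd_above_def)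
  then have "norm (x k - y k) \<le> A + B" if "k \<in> I" for k
    using norm_triangle_ineq4[of "x k" "y k"] that by (meson add_mono order_trans)
  then show ?thesis using PInf by (auto simp: in_ell_def intro!: bdd_aboveI2)
qed (use s in simp)

lemma conjugate_exponents_cases:
  fixes s t :: ereal
  assumes "1 \<le> s" "1 \<le> t" "1 / s + 1 / t = 1"
  obtains (one_infinity) "s = 1" "t = \<infinity>"
    | (infinity_one) "s = \<infinity>" "t = 1"
    | (finite) a b where "s = ereal a" "t = ereal b" "1 < a" "1 < b" "1 / a + 1 / b = 1"
proof (cases s; cases t)
  fix a b assume st: "s = ereal a" "t = ereal b"
  then have ab: "1 \<le> a" "1 \<le> b" using assms by simp_all
  have sum: "1 / a + 1 / b = 1" using assms(3) ab by (simp add: st one_ereal_def)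
  have "0 < 1 / a" "0 < 1 / b" using ab by simp_all
  then have "a \<noteq> 1" "b \<noteq> 1" using sum by auto
  then show thesis using finite[OF st] ab sum by simp
next
  fix a assume st: "s = ereal a" "t = \<infinity>"
  then have "1 \<le> a" using assms by simp
  then have "a = 1" using assms(3) by (simp add: st one_ereal_def)
  then show thesis using one_infinity st by (simp add: one_ereal_def)
next
  fix b assume st: "s = \<infinity>" "t = ereal b"
  then have "1 \<le> b" using assms by simp
  then have "b = 1" using assms(3) by (simp add: st one_ereal_def)
  then show thesis using infinity_one st by (simp add: one_ereal_def)
qed (use assms in \<open>auto simp: zero_ereal_def one_ereal_def\<close>)

text \<open>Normalise both factors to norm one and sum Young's inequality.\<close>

lemma Hoelder_sum:
  fixes a b :: "'i \<Rightarrow> real"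
  assumes st: "1 < s" "1 < t" "1 / s + 1 / t = 1"
    and pos: "\<And>k. k \<in> F \<Longrightarrow> 0 \<le> a k" "\<And>k. k \<in> F \<Longrightarrow> 0 \<le> b k"
    and fin: "finite F"
  shows "(\<Sum>k\<in>F. a k * b k) \<le> (\<Sum>k\<in>F. a k powr s) powr (1 / s) * (\<Sum>k\<in>F. b k powr t) powr (1 / t)"
proof -
  define A B where "A = (\<Sum>k\<in>F. a k powr s)" and "B = (\<Sum>k\<in>F. b k powr t)"
  have AB: "0 \<le> A" "0 \<le> B" by (auto simp: A_def B_def intro: sum_nonneg)
  show ?thesis
  proof (cases "A = 0 \<or> B = 0")
    case True
    then have "a k * b k = 0" if "k \<in> F" for k
      using that fin by (auto simp: A_def B_def sum_nonneg_eq_0_iff)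
    then have "(\<Sum>k\<in>F. a k * b k) = 0" by (intro sum.neutral ballI)
    then show ?thesis by simp
  next
    case False
    then have "0 < A" "0 < B" using AB by simp_all
    define u v where "u = A powr (1 / s)" and "v = B powr (1 / t)"
    have uv: "0 < u" "0 < v" "u powr s = A" "v powr t = B"
      using \<open>0 < A\<close> \<open>0 < B\<close> st by (simp_all add: u_def v_def powr_powr)
    have "(\<Sum>k\<in>F. (a k / u) * (b k / v)) \<le> (\<Sum>k\<in>F. (a k / u) powr s / s + (b k / v) powr t / t)"
      using st pos uv by (intro sum_mono Youngs_inequality) auto
    also have "\<dots> = (\<Sum>k\<in>F. a k powr s / A / s + b k powr t / B / t)"
      using pos uv by (intro sum.cong) (simp_all add: powr_divide)
    also have "\<dots> = A / A / s + B / B / t"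
      by (simp add: sum.distrib A_def B_def flip: sum_divide_distrib)
    also have "\<dots> = 1" using \<open>0 < A\<close> \<open>0 < B\<close> st by simp
    finally have "(\<Sum>k\<in>F. a k * b k) / (u * v) \<le> 1" by (simp add: sum_divide_distrib)
    then have "(\<Sum>k\<in>F. a k * b k) \<le> u * v" using uv by (simp add: field_simps)
    then show ?thesis by (simp add: u_def v_def A_def B_def)
  qed
qed

text \<open>Both statements come from a bound on the finite sums that is uniform in the finite set. For the
exponents \<open>1\<close> and \<open>\<infinity>\<close> it is obtained by estimating one factor by its supremum.\<close>

theorem
  assumes st: "1 \<le> s" "1 \<le> t" "1 / s + 1 / t = 1"
    and x: "in_ell s I x" and y: "in_ell t I y"
  shows summable_on_Hoelder: "(\<lambda>k. norm (x k) * norm (y k)) summable_on I"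
    and Hoelder_infsum: "(\<Sum>\<^sub>\<infinity>k\<in>I. norm (x k) * norm (y k)) \<le> ell_norm s I x * ell_norm t I y"
proof -
  have fin: "(\<Sum>k\<in>F. norm (x k) * norm (y k)) \<le> ell_norm s I x * ell_norm t I y"
    if F: "finite F" "F \<subseteq> I" for F
    using st
  proof (cases rule: conjugate_exponents_cases)
    case one_infinity
    have "(\<Sum>k\<in>F. norm (x k) * norm (y k)) \<le> (\<Sum>k\<in>F. norm (x k)) * ell_norm t I y"
      unfolding sum_distrib_right using F norm_le_ell_norm[OF st(2) y]
      by (intro sum_mono mult_left_mono) auto
    also have "\<dots> \<le> ell_norm s I x * ell_norm t I y"
      using x F one_infinity ell_norm_nonneg[OF y]
      by (intro mult_right_mono) (auto simp: ell_norm_one in_ell_one intro: finite_sum_le_infsum)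
    finally show ?thesis .
  next
    case infinity_one
    have "(\<Sum>k\<in>F. norm (x k) * norm (y k)) \<le> ell_norm s I x * (\<Sum>k\<in>F. norm (y k))"
      unfolding sum_distrib_left using F norm_le_ell_norm[OF st(1) x]
      by (intro sum_mono mult_right_mono) auto
    also have "\<dots> \<le> ell_norm s I x * ell_norm t I y"
      using y F infinity_one ell_norm_nonneg[OF x]
      by (intro mult_left_mono) (auto simp: ell_norm_one in_ell_one intro: finite_sum_le_infsum)
    finally show ?thesis .
  next
    case (finite a b)
    have "(\<Sum>k\<in>F. norm (x k) * norm (y k)) \<le> ell_norm s F x * ell_norm t F y"
      using Hoelder_sum[OF finite(3-5), of F "\<lambda>k. norm (x k)" "\<lambda>k. norm (y k)"] F finite
      by (simp add: ell_norm_ereal)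
    also have "\<dots> \<le> ell_norm s I x * ell_norm t I y"
      using x y F finite by (intro mult_mono ell_norm_nonneg) (auto intro: ell_norm_subset in_ell_subset)
    finally show ?thesis .
  qed
  show sum: "(\<lambda>k. norm (x k) * norm (y k)) summable_on I"
    using fin by (intro nonneg_bdd_above_summable_on bdd_aboveI2) auto
  show "(\<Sum>\<^sub>\<infinity>k\<in>I. norm (x k) * norm (y k)) \<le> ell_norm s I x * ell_norm t I y"
    using sum fin by (rule infsum_le_finite_sums)
qed

section \<open>Bessel sequences and multipliers\<close>

text \<open>The Cauchy criterion for unordered sums: the finite sums of \<open>f\<close> outside a large finite set are small
because those of \<open>g\<close> are. The series of \<open>f\<close> need not converge absolutely, so
a comparison with the sum of its norms would not do.\<close>

lemma
  fixes f :: "'i \<Rightarrow> 'b::banach" and g :: "'i \<Rightarrow> real"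
  assumes g: "g summable_on I" and pos: "\<And>k. k \<in> I \<Longrightarrow> 0 \<le> g k"
    and r: "0 < r" and K: "0 \<le> K"
    and le: "\<And>F. finite F \<Longrightarrow> F \<subseteq> I \<Longrightarrow> norm (sum f F) \<le> K * sum g F powr r"
  shows summable_on_if_dominated_sums: "f summable_on I"
    and norm_infsum_le_if_dominated_sums: "norm (infsum f I) \<le> K * infsum g I powr r"
proof -
  have "\<exists>P. eventually P (finite_subsets_at_top I) \<and>
            (\<forall>F F'. P F \<and> P F' \<longrightarrow> dist (sum f F) (sum f F') < e)" if "0 < e" for e
  proof -
    \<comment> \<open>chosen so that \<open>K * d powr r < e / 2\<close>; the summand \<open>1\<close> takes care of \<open>K = 0\<close>\<close>
    define d where "d = (e / (2 * (K + 1))) powr (1 / r)"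
    have "0 < d" and d: "d powr r = e / (2 * (K + 1))" using \<open>0 < e\<close> K r by (simp_all add: d_def powr_powr)
    have "K * d powr r < e / 2" using \<open>0 < e\<close> K by (simp add: d field_simps)
    obtain F0 where F0: "finite F0" "F0 \<subseteq> I" "dist (sum g F0) (infsum g I) \<le> d"
      using infsum_finite_approximation[OF g \<open>0 < d\<close>] by blast
    define P where "P F \<longleftrightarrow> finite F \<and> F0 \<subseteq> F \<and> F \<subseteq> I" for F
    have "eventually P (finite_subsets_at_top I)"
      using F0 by (auto simp: eventually_finite_subsets_at_top P_def)
    moreover have near: "dist (sum f F) (sum f F0) < e / 2" if "P F" for F
    proof -
      have F: "finite F" "F0 \<subseteq> F" "F \<subseteq> I" using that by (simp_all add: P_def)
      have "sum g F \<le> infsum g I" using F pos by (intro finite_sum_le_infsum g) auto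
      then have "sum g (F - F0) \<le> d" using F F0(3) by (simp add: sum_diff dist_real_def)
      moreover have "0 \<le> sum g (F - F0)" using F pos by (intro sum_nonneg) auto
      ultimately have "K * sum g (F - F0) powr r \<le> K * d powr r"
        using K r by (intro mult_left_mono powr_mono2) auto
      moreover have "dist (sum f F) (sum f F0) \<le> K * sum g (F - F0) powr r"
        using le[of "F - F0"] F by (auto simp: dist_norm sum_diff)
      ultimately show ?thesis using \<open>K * d powr r < e / 2\<close> by linarith
    qed
    moreover have "dist (sum f F) (sum f F') < e" if "P F" "P F'" for F F'
      using near[OF that(1)] near[OF that(2)] by (rule dist_triangle_half_l)
    ultimately show ?thesis by blast
  qed
  then have "cauchy_filter (filtermap (sum f) (finite_subsets_at_top I))"
    by (simp add: cauchy_filter_metric_filtermap)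
  moreover have "complete (UNIV :: 'b set)" by (rule complete_UNIV)
  ultimately obtain L where "(sum f \<longlongrightarrow> L) (finite_subsets_at_top I)"
    using complete_uniform[where S = "UNIV :: 'b set"] by (force simp add: filterlim_def)
  then show f: "f summable_on I" by (auto simp: summable_on_def has_sum_def)
  have "norm (sum f F) \<le> K * infsum g I powr r" if F: "finite F" "F \<subseteq> I" for F
  proof -
    have "sum g F \<le> infsum g I" using F pos by (intro finite_sum_le_infsum g) auto
    moreover have "0 \<le> sum g F" using F pos by (intro sum_nonneg) auto
    ultimately have "K * sum g F powr r \<le> K * infsum g I powr r"
      using K r by (intro mult_left_mono powr_mono2) auto
    then show ?thesis using le[OF F] by linarith
  qed
  then show "norm (infsum f I) \<le> K * infsum g I powr r"
    using has_sum_infsum[OF f] unfolding has_sum_def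
    by (intro tendsto_upperbound[OF tendsto_norm] eventually_finite_subsets_at_top_weakI) auto
qed

text \<open>The Bessel inequalities with their constants named and stated in terms of \<open>\<ell>\<^sup>p\<close> norms, so that
Hoelder's inequality applies to them directly.\<close>

definition analysis_bound ::
    "real \<Rightarrow> 'i set \<Rightarrow> ('i \<Rightarrow> 'a::real_normed_vector \<Rightarrow>\<^sub>L 'k::real_normed_vector) \<Rightarrow> real \<Rightarrow> bool" where
  "analysis_bound p I \<psi> B \<longleftrightarrow> 0 \<le> B \<and>
     (\<forall>f. in_ell (ereal p) I (\<lambda>k. blinfun_apply (\<psi> k) f) \<and>
          ell_norm (ereal p) I (\<lambda>k. blinfun_apply (\<psi> k) f) \<le> B * norm f)"

definition synthesis_bound ::
    "('k::real_or_complex \<Rightarrow> 'b::banach \<Rightarrow> 'b) \<Rightarrow> real \<Rightarrow> 'i set \<Rightarrow> ('i \<Rightarrow> 'b) \<Rightarrow> real \<Rightarrow> bool" where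
  "synthesis_bound smul q I \<phi> B \<longleftrightarrow> 0 \<le> B \<and>
     (\<forall>h\<in>dual_space smul. in_ell (ereal q) I (\<lambda>k. blinfun_apply h (\<phi> k)) \<and>
          ell_norm (ereal q) I (\<lambda>k. blinfun_apply h (\<phi> k)) \<le> B * norm h)"

lemma bessel_seq_analysis_bound:
  assumes "bessel_seq smul p I \<psi>"
  obtains B where "analysis_bound p I \<psi> B"
  using assms unfolding bessel_seq_def analysis_bound_def in_ell_ereal ell_norm_ereal
  by (meson less_imp_le)

lemma bessel_seq_dual_synthesis_bound:
  assumes "bessel_seq_dual smul q I \<phi>"
  obtains B where "synthesis_bound smul q I \<phi> B"
  using assms unfolding bessel_seq_dual_def synthesis_bound_def in_ell_ereal ell_norm_ereal
  by (meson less_imp_le)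

lemma norm_le_analysis_bound:
  assumes \<psi>: "analysis_bound p I \<psi> B" and p: "1 \<le> p" and k: "k \<in> I"
  shows "norm (\<psi> k) \<le> B"
proof (rule norm_blinfun_bound)
  show "norm (blinfun_apply (\<psi> k) f) \<le> B * norm f" for f
    using norm_le_ell_norm[of "ereal p" I "\<lambda>k. blinfun_apply (\<psi> k) f" k] \<psi> p k
    by (auto simp: analysis_bound_def intro: order_trans)
qed (use \<psi> in \<open>simp add: analysis_bound_def\<close>)

context banach_over
begin

lemma norm_le_synthesis_bound:
  assumes \<phi>: "synthesis_bound smul q I \<phi> B" and q: "1 \<le> q" and k: "k \<in> I"
  shows "norm (\<phi> k) \<le> B"
proof -
  obtain h where h: "h \<in> dual_space smul" "norm h \<le> 1" "norm (blinfun_apply h (\<phi> k)) = norm (\<phi> k)"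
    using dual_space_norming by blast
  have "norm (\<phi> k) \<le> ell_norm (ereal q) I (\<lambda>k. blinfun_apply h (\<phi> k))"
    using norm_le_ell_norm[of "ereal q" I "\<lambda>k. blinfun_apply h (\<phi> k)" k] \<phi> h q k
    by (simp add: synthesis_bound_def)
  also have "\<dots> \<le> B * norm h" using \<phi> h by (simp add: synthesis_bound_def)
  also have "\<dots> \<le> B" using \<phi> h mult_left_le[of "norm h" B] by (simp add: synthesis_bound_def)
  finally show ?thesis .
qed

text \<open>The synthesis operator of a \<open>q\<close>-Bessel family is bounded on \<open>\<ell>\<^sup>p\<close>, being dual to the analysis
operator: a norming functional of a finite partial sum turns its norm into a scalar sum, to which
Hoelder's inequality applies. Restricting the coefficients to a finite set makes the bound small
where the tail of \<open>\<bar>c\<^sub>k\<bar>\<^sup>p\<close> is, and this yields convergence.\<close>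

theorem
  assumes pq: "1 < p" "1 < q" "1 / p + 1 / q = 1"
    and \<phi>: "synthesis_bound smul q I \<phi> B" and c: "in_ell (ereal p) I c"
  shows summable_on_synthesis: "(\<lambda>k. smul (c k) (\<phi> k)) summable_on I"
    and norm_synthesis_le: "norm (\<Sum>\<^sub>\<infinity>k\<in>I. smul (c k) (\<phi> k)) \<le> B * ell_norm (ereal p) I c"
proof -
  have B: "0 \<le> B" using \<phi> by (simp add: synthesis_bound_def)
  have fin: "norm (\<Sum>k\<in>F. smul (c k) (\<phi> k)) \<le> B * (\<Sum>k\<in>F. norm (c k) powr p) powr (1 / p)"
    if F: "finite F" "F \<subseteq> I" for F
  proof -
    define y where "y = (\<Sum>k\<in>F. smul (c k) (\<phi> k))"
    obtain h where h: "h \<in> dual_space smul" "norm h \<le> 1" "norm (blinfun_apply h y) = norm y"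
      using dual_space_norming by blast
    have hI: "in_ell (ereal q) I (\<lambda>k. blinfun_apply h (\<phi> k))"
      and "ell_norm (ereal q) I (\<lambda>k. blinfun_apply h (\<phi> k)) \<le> B * norm h"
      using \<phi> h by (simp_all add: synthesis_bound_def)
    moreover have "B * norm h \<le> B" using B h by (simp add: mult_left_le)
    moreover have "ell_norm (ereal q) F (\<lambda>k. blinfun_apply h (\<phi> k))
        \<le> ell_norm (ereal q) I (\<lambda>k. blinfun_apply h (\<phi> k))"
      using hI F pq by (intro ell_norm_subset) auto
    ultimately have hF: "ell_norm (ereal q) F (\<lambda>k. blinfun_apply h (\<phi> k)) \<le> B" by linarith
    have conj: "1 / ereal p + 1 / ereal q = 1" using pq by (simp add: one_ereal_def)
    have "blinfun_apply h y = (\<Sum>k\<in>F. c k * blinfun_apply h (\<phi> k))"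
      using h(1) by (simp add: y_def blinfun.sum_right dual_space_def)
    then have "norm y \<le> (\<Sum>k\<in>F. norm (c k) * norm (blinfun_apply h (\<phi> k)))"
      using norm_sum[of "\<lambda>k. c k * blinfun_apply h (\<phi> k)" F] h(3) by (simp add: norm_mult)
    also have "\<dots> \<le> ell_norm (ereal p) F c * ell_norm (ereal q) F (\<lambda>k. blinfun_apply h (\<phi> k))"
      using Hoelder_infsum[OF _ _ conj in_ell_subset[OF c F(2)] in_ell_subset[OF hI F(2)]] F pq
      by simp
    also have "\<dots> \<le> ell_norm (ereal p) F c * B"
      using hF c F by (intro mult_left_mono ell_norm_nonneg in_ell_subset[OF c])
    finally show ?thesis using F by (simp add: y_def ell_norm_ereal mult.commute)
  qed
  have g: "(\<lambda>k. norm (c k) powr p) summable_on I" using c by (simp add: in_ell_ereal)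
  show "(\<lambda>k. smul (c k) (\<phi> k)) summable_on I"
    by (rule summable_on_if_dominated_sums[OF g _ _ B fin]) (use pq in auto)
  show "norm (\<Sum>\<^sub>\<infinity>k\<in>I. smul (c k) (\<phi> k)) \<le> B * ell_norm (ereal p) I c"
    unfolding ell_norm_ereal
    by (rule norm_infsum_le_if_dominated_sums[OF g _ _ B fin]) (use pq in auto)
qed

text \<open>Only the supremum of the symbol matters here; it is dominated by the norm with any exponent
\<open>s \<ge> 1\<close>.\<close>

lemma
  assumes pq: "1 < p" "1 < q" "1 / p + 1 / q = 1"
    and \<psi>: "analysis_bound p I \<psi> B1" and \<phi>: "synthesis_bound smul q I \<phi> B2"
    and s: "1 \<le> s" and m: "in_ell s I m"
  shows summable_on_multiplier:
      "(\<lambda>k. smul (m k * blinfun_apply (\<psi> k) f) (\<phi> k)) summable_on I"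
    and norm_multiplier_le:
      "norm (multiplier smul I m \<phi> \<psi> f) \<le> ell_norm s I m * B1 * B2 * norm f"
proof -
  have \<psi>f: "in_ell (ereal p) I (\<lambda>k. blinfun_apply (\<psi> k) f)"
    and \<psi>f_le: "ell_norm (ereal p) I (\<lambda>k. blinfun_apply (\<psi> k) f) \<le> B1 * norm f"
    using \<psi> by (simp_all add: analysis_bound_def)
  have M: "0 \<le> ell_norm s I m" using m by (rule ell_norm_nonneg)
  have B2: "0 \<le> B2" using \<phi> by (simp add: synthesis_bound_def)
  have le: "norm (m k * blinfun_apply (\<psi> k) f) \<le> ell_norm s I m * norm (blinfun_apply (\<psi> k) f)"
    if "k \<in> I" for k
    using norm_le_ell_norm[OF s m that] by (simp add: norm_mult mult_right_mono)
  have c: "in_ell (ereal p) I (\<lambda>k. m k * blinfun_apply (\<psi> k) f)"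
    using pq by (intro in_ell_dominated[OF _ \<psi>f M le]) auto
  show "(\<lambda>k. smul (m k * blinfun_apply (\<psi> k) f) (\<phi> k)) summable_on I"
    by (rule summable_on_synthesis[OF pq \<phi> c])
  have "norm (multiplier smul I m \<phi> \<psi> f)
      \<le> B2 * ell_norm (ereal p) I (\<lambda>k. m k * blinfun_apply (\<psi> k) f)"
    unfolding multiplier_def by (rule norm_synthesis_le[OF pq \<phi> c])
  also have "\<dots> \<le> B2 * (ell_norm s I m * ell_norm (ereal p) I (\<lambda>k. blinfun_apply (\<psi> k) f))"
    using pq B2 by (intro mult_left_mono ell_norm_dominated[OF _ \<psi>f M le]) auto
  also have "\<dots> \<le> B2 * (ell_norm s I m * (B1 * norm f))"
    using B2 M \<psi>f_le by (intro mult_left_mono) auto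
  finally show "norm (multiplier smul I m \<phi> \<psi> f) \<le> ell_norm s I m * B1 * B2 * norm f"
    by (simp add: algebra_simps)
qed

text \<open>The only Bessel bounds in this estimate are those of the unprimed families, which stay fixed when
the primed ones converge to them.\<close>

theorem norm_multiplier_diff_le:
  fixes m m' :: "'i \<Rightarrow> 'k" and \<phi> \<phi>' :: "'i \<Rightarrow> 'a" and \<psi> \<psi>' :: "'i \<Rightarrow> 'c::banach \<Rightarrow>\<^sub>L 'k"
  assumes pq: "1 < p" "1 < q" "1 / p + 1 / q = 1"
    and st: "1 \<le> s" "1 \<le> t" "1 / s + 1 / t = 1"
    and \<psi>: "analysis_bound p I \<psi> B1" and \<phi>: "synthesis_bound smul q I \<phi> B2"
    and m: "in_ell s I m" and \<mu>: "in_ell s I (\<lambda>k. m' k - m k)"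
    and \<eta>: "in_ell t I (\<lambda>k. \<psi>' k - \<psi> k)" and \<delta>: "in_ell t I (\<lambda>k. \<phi>' k - \<phi> k)"
  defines "M \<equiv> ell_norm s I m" and "u \<equiv> ell_norm s I (\<lambda>k. m' k - m k)"
    and "e \<equiv> ell_norm t I (\<lambda>k. \<psi>' k - \<psi> k)" and "d \<equiv> ell_norm t I (\<lambda>k. \<phi>' k - \<phi> k)"
  shows "norm (multiplier smul I m' \<phi>' \<psi>' f - multiplier smul I m \<phi> \<psi> f)
      \<le> (u * B1 * B2 + (M + u) * (e * B2 + d * (B1 + e))) * norm f"
proof -
  have nonneg: "0 \<le> B1" "0 \<le> B2" "0 \<le> e"
    using \<psi> \<phi> ell_norm_nonneg[OF \<eta>] by (simp_all add: analysis_bound_def synthesis_bound_def e_def)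
  \<comment> \<open>The Hoelder estimate for series that contain \<open>m'\<close>. Splitting \<open>m'\<close> into \<open>m\<close> and \<open>m' - m\<close>
      before applying the inequality avoids the triangle inequality in \<open>\<ell>\<close>.\<close>
  have abs: "T summable_on I \<and> norm (infsum T I) \<le> (M + u) * ell_norm t I y * C"
    if y: "in_ell t I y" and C: "0 \<le> C"
      and T: "\<And>k. k \<in> I \<Longrightarrow> norm (T k) \<le> norm (m' k) * norm (y k) * C"
    for T :: "'i \<Rightarrow> 'a" and y :: "'i \<Rightarrow> 'd::real_normed_vector" and C
  proof -
    let ?g = "\<lambda>k. (norm (m k) * norm (y k) + norm (m' k - m k) * norm (y k)) * C"
    have g: "?g summable_on I"
      by (intro summable_on_cmult_left summable_on_add summable_on_Hoelder[OF st] m \<mu> y)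
    have Tg: "norm (T k) \<le> ?g k" if "k \<in> I" for k
    proof -
      have "norm (m' k) * norm (y k) \<le> norm (m k) * norm (y k) + norm (m' k - m k) * norm (y k)"
        using norm_triangle_sub[of "m' k" "m k"]
        by (simp add: mult_right_mono flip: distrib_right)
      then show ?thesis using T[OF that] C by (meson mult_right_mono order_trans)
    qed
    then have T_abs: "(\<lambda>k. norm (T k)) summable_on I"
      by (rule summable_on_comparison_test[OF g]) (simp_all add: Tg)
    then have "T summable_on I" by (rule abs_summable_summable)
    moreover have "norm (infsum T I) \<le> (\<Sum>\<^sub>\<infinity>k\<in>I. ?g k)"
      using norm_infsum_bound[OF T_abs] infsum_mono[OF T_abs g Tg] by linarith
    moreover have "(\<Sum>\<^sub>\<infinity>k\<in>I. ?g k)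
        = ((\<Sum>\<^sub>\<infinity>k\<in>I. norm (m k) * norm (y k)) + (\<Sum>\<^sub>\<infinity>k\<in>I. norm (m' k - m k) * norm (y k))) * C"
      by (simp add: infsum_cmult_left' infsum_add summable_on_Hoelder[OF st] m \<mu> y)
    moreover have "\<dots> \<le> (M * ell_norm t I y + u * ell_norm t I y) * C"
      unfolding M_def u_def
      by (intro mult_right_mono add_mono Hoelder_infsum[OF st] m \<mu> y C)
    ultimately show ?thesis by (simp add: algebra_simps)
  qed
  let ?T = "\<lambda>m \<phi> (\<psi>::'i \<Rightarrow> 'c \<Rightarrow>\<^sub>L 'k) k. smul (m k * blinfun_apply (\<psi> k) f) (\<phi> k)"
  let ?T1 = "?T (\<lambda>k. m' k - m k) \<phi> \<psi>"
    and ?T2 = "?T m' \<phi> (\<lambda>k. \<psi>' k - \<psi> k)"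
    and ?T3 = "?T m' (\<lambda>k. \<phi>' k - \<phi> k) \<psi>'"
  have T2: "?T2 summable_on I \<and> norm (infsum ?T2 I) \<le> (M + u) * e * (norm f * B2)"
    unfolding e_def
  proof (rule abs[OF \<eta>])
    fix k assume k: "k \<in> I"
    have "norm (blinfun_apply (\<psi>' k - \<psi> k) f) * norm (\<phi> k) \<le> (norm (\<psi>' k - \<psi> k) * norm f) * B2"
      using norm_blinfun norm_le_synthesis_bound[OF \<phi> _ k] pq by (intro mult_mono) auto
    then have "norm (m' k) * (norm (blinfun_apply (\<psi>' k - \<psi> k) f) * norm (\<phi> k))
        \<le> norm (m' k) * ((norm (\<psi>' k - \<psi> k) * norm f) * B2)"
      by (rule mult_left_mono) simp
    then show "norm (?T2 k) \<le> norm (m' k) * norm (\<psi>' k - \<psi> k) * (norm f * B2)"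
      by (simp add: norm_smul norm_mult mult.assoc)
  qed (use nonneg in simp)
  have T3: "?T3 summable_on I \<and> norm (infsum ?T3 I) \<le> (M + u) * d * ((B1 + e) * norm f)"
    unfolding d_def
  proof (rule abs[OF \<delta>])
    fix k assume k: "k \<in> I"
    have "norm (\<psi>' k) \<le> B1 + e"
      using norm_triangle_sub[of "\<psi>' k" "\<psi> k"] norm_le_analysis_bound[OF \<psi> _ k] pq
        norm_le_ell_norm[OF st(2) \<eta> k] by (simp add: e_def)
    then have "norm (blinfun_apply (\<psi>' k) f) \<le> (B1 + e) * norm f"
      using norm_blinfun[of "\<psi>' k" f] by (meson mult_right_mono norm_ge_zero order_trans)
    then have "(norm (m' k) * norm (\<phi>' k - \<phi> k)) * norm (blinfun_apply (\<psi>' k) f)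
        \<le> (norm (m' k) * norm (\<phi>' k - \<phi> k)) * ((B1 + e) * norm f)"
      by (rule mult_left_mono) simp
    then show "norm (?T3 k) \<le> norm (m' k) * norm (\<phi>' k - \<phi> k) * ((B1 + e) * norm f)"
      by (simp add: norm_smul norm_mult mult_ac)
  qed (use nonneg in simp)
  have T0: "?T m \<phi> \<psi> summable_on I"
    by (rule summable_on_multiplier[OF pq \<psi> \<phi> st(1) m])
  have T1: "?T1 summable_on I" "norm (infsum ?T1 I) \<le> u * B1 * B2 * norm f"
    using summable_on_multiplier[OF pq \<psi> \<phi> st(1) \<mu>] norm_multiplier_le[OF pq \<psi> \<phi> st(1) \<mu>, of f]
    by (simp_all add: u_def multiplier_def)
  have "?T m' \<phi>' \<psi>' k = ?T m \<phi> \<psi> k + ?T1 k + ?T2 k + ?T3 k" for k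
    by (simp add: blinfun.diff_left scale_right_diff_distrib algebra_simps
        flip: scale_left_distrib scale_left_diff_distrib)
  then have "multiplier smul I m' \<phi>' \<psi>' f
      = multiplier smul I m \<phi> \<psi> f + infsum ?T1 I + infsum ?T2 I + infsum ?T3 I"
    using T0 T1(1) T2 T3 by (simp add: multiplier_def infsum_add summable_on_add)
  then have "norm (multiplier smul I m' \<phi>' \<psi>' f - multiplier smul I m \<phi> \<psi> f)
      \<le> norm (infsum ?T1 I) + norm (infsum ?T2 I) + norm (infsum ?T3 I)"
    using norm_triangle_ineq[of "infsum ?T1 I + infsum ?T2 I" "infsum ?T3 I"]
      norm_triangle_ineq[of "infsum ?T1 I" "infsum ?T2 I"] by (simp add: algebra_simps)
  also have "\<dots> \<le> u * B1 * B2 * norm f + (M + u) * e * (norm f * B2) + (M + u) * d * ((B1 + e) * norm f)"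
    using T1(2) T2 T3 by linarith
  finally show ?thesis by (simp add: algebra_simps)
qed

end

text \<open>The operator norm is a supremum of quotients and could be any real number if they were unbounded;
once they are bounded, the quotient at \<open>0\<close>, which is \<open>0\<close>, is a lower bound of the supremum.\<close>

lemma onorm_nonneg_if_bounded:
  assumes "\<And>x. norm (f x) \<le> b * norm x"
  shows "0 \<le> onorm f"
proof -
  have "norm (f x) \<le> \<bar>b\<bar> * norm x" for x
    using assms[of x] mult_right_mono[OF abs_ge_self[of b] norm_ge_zero] by (rule order_trans)
  then have "norm (f x) / norm x \<le> \<bar>b\<bar>" for x
    by (cases "x = 0") (simp_all add: pos_divide_le_eq)
  then have "norm (f 0) / norm (0::'a) \<le> onorm f"
    unfolding onorm_def by (intro cSUP_upper bdd_aboveI2) auto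
  then show ?thesis by simp
qed

theorem (in banach_over) onorm_multiplier_diff_tendsto_zero:
  fixes \<psi> :: "'i \<Rightarrow> 'c::banach \<Rightarrow>\<^sub>L 'k"
  assumes pq: "1 < p" "1 < q" "1 / p + 1 / q = 1"
    and st: "1 \<le> s" "1 \<le> t" "1 / s + 1 / t = 1"
    and \<psi>: "analysis_bound p I \<psi> B1" and \<phi>: "synthesis_bound smul q I \<phi> B2"
    and ml: "converges_in_ell s I ml m"
    and \<psi>l: "converges_in_ell_sense t I \<psi>l \<psi>" and \<phi>l: "converges_in_ell_sense t I \<phi>l \<phi>"
  shows "(\<lambda>l. onorm (\<lambda>f. multiplier smul I (ml l) (\<phi>l l) (\<psi>l l) f - multiplier smul I m \<phi> \<psi> f))
           \<longlonglongrightarrow> 0"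
proof -
  \<comment> \<open>Stated for an arbitrary target space because it is applied both to functionals and to vectors.\<close>
  have sense: "(\<forall>\<^sub>F l in sequentially. in_ell t I (\<lambda>k. \<xi>l l k - \<xi> k)) \<and>
      (\<lambda>l. ell_norm t I (\<lambda>k. \<xi>l l k - \<xi> k)) \<longlonglongrightarrow> 0"
    if "converges_in_ell_sense t I \<xi>l \<xi>" for \<xi>l and \<xi> :: "'i \<Rightarrow> 'd::real_normed_vector"
  proof
    have *: "\<forall>\<^sub>F l in sequentially. in_ell t I (\<lambda>k. \<xi>l l k - \<xi> k) \<and>
        ell_norm t I (\<lambda>k. \<xi>l l k - \<xi> k) < r" if "0 < r" for r
      using \<open>converges_in_ell_sense t I \<xi>l \<xi>\<close> that
      unfolding converges_in_ell_sense_def eventually_sequentially by blast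
    show "\<forall>\<^sub>F l in sequentially. in_ell t I (\<lambda>k. \<xi>l l k - \<xi> k)"
      using *[of 1] by (auto elim: eventually_mono)
    show "(\<lambda>l. ell_norm t I (\<lambda>k. \<xi>l l k - \<xi> k)) \<longlonglongrightarrow> 0"
    proof (rule tendstoI)
      fix r :: real assume "0 < r"
      then show "\<forall>\<^sub>F l in sequentially. dist (ell_norm t I (\<lambda>k. \<xi>l l k - \<xi> k)) 0 < r"
        using *[of r] by (auto elim!: eventually_mono simp: ell_norm_nonneg)
    qed
  qed
  define M u e d where "M = ell_norm s I m" and "u l = ell_norm s I (\<lambda>k. ml l k - m k)"
    and "e l = ell_norm t I (\<lambda>k. \<psi>l l k - \<psi> k)" and "d l = ell_norm t I (\<lambda>k. \<phi>l l k - \<phi> k)" for l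
  let ?D = "\<lambda>l f. multiplier smul I (ml l) (\<phi>l l) (\<psi>l l) f - multiplier smul I m \<phi> \<psi> f"
  let ?K = "\<lambda>l. u l * B1 * B2 + (M + u l) * (e l * B2 + d l * (B1 + e l))"
  have m: "in_ell s I m" and \<mu>: "in_ell s I (\<lambda>k. ml l k - m k)" for l
    using ml in_ell_diff[OF st(1)] by (auto simp: converges_in_ell_def)
  have lim: "u \<longlonglongrightarrow> 0" "e \<longlonglongrightarrow> 0" "d \<longlonglongrightarrow> 0"
    using ml sense[OF \<psi>l] sense[OF \<phi>l] by (simp_all add: converges_in_ell_def u_def[abs_def] e_def[abs_def] d_def[abs_def])
  have ev: "\<forall>\<^sub>F l in sequentially. 0 \<le> onorm (?D l) \<and> onorm (?D l) \<le> ?K l"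
    using conjunct1[OF sense[OF \<psi>l]] conjunct1[OF sense[OF \<phi>l]]
  proof eventually_elim
    case (elim l)
    have bound: "norm (?D l f) \<le> ?K l * norm f" for f
      unfolding M_def u_def e_def d_def
      by (rule norm_multiplier_diff_le[OF pq st \<psi> \<phi> m \<mu> elim])
    have "0 \<le> M" "0 \<le> u l" "0 \<le> e l" "0 \<le> d l" "0 \<le> B1" "0 \<le> B2"
      using m \<mu> elim \<psi> \<phi>
      by (simp_all add: M_def u_def e_def d_def ell_norm_nonneg analysis_bound_def synthesis_bound_def)
    then have "0 \<le> ?K l" by simp
    then show ?case using bound by (intro conjI onorm_bound onorm_nonneg_if_bounded)
  qed
  have "?K \<longlonglongrightarrow> 0 * B1 * B2 + (M + 0) * (0 * B2 + 0 * (B1 + 0))"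
    by (intro tendsto_intros lim)
  then have K: "?K \<longlonglongrightarrow> 0" by simp
  show ?thesis
    using ev by (intro tendsto_sandwich[OF _ _ tendsto_const K]) (auto elim: eventually_mono)
qed

lemma converges_in_ell_sense_const: "converges_in_ell_sense s I (\<lambda>l. \<xi>) \<xi>"
  by (simp add: converges_in_ell_sense_def in_ell_zero ell_norm_zero)

lemma converges_in_ell_const: "in_ell s I m \<Longrightarrow> converges_in_ell s I (\<lambda>l. m) m"
  by (simp add: converges_in_ell_def ell_norm_zero)

theorem theorem4p1:
  fixes p q :: real
    and p1 q1 :: ereal
    and smul1 :: "'k::real_or_complex \<Rightarrow> 'a::banach \<Rightarrow> 'a"
    and smul2 :: "'k \<Rightarrow> 'b::banach \<Rightarrow> 'b"
    and I :: "'i set"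
    and \<psi> :: "'i \<Rightarrow> 'a \<Rightarrow>\<^sub>L 'k" and \<psi>l :: "nat \<Rightarrow> 'i \<Rightarrow> 'a \<Rightarrow>\<^sub>L 'k"
    and \<phi> :: "'i \<Rightarrow> 'b" and \<phi>l :: "nat \<Rightarrow> 'i \<Rightarrow> 'b"
    and m :: "'i \<Rightarrow> 'k" and ml :: "nat \<Rightarrow> 'i \<Rightarrow> 'k"
  assumes "p > 0" "q > 0" "1 / p + 1 / q = 1"
    and "banach_over smul1" "separable_space (euclidean :: 'a topology)" "reflexive_space smul1"
    and "banach_over smul2" "separable_space (euclidean :: 'b topology)" "reflexive_space smul2"
    and "countable I"
    and "bessel_seq smul1 p I \<psi>" "bessel_seq_dual smul2 q I \<phi>"
    and "\<And>l. bessel_seq smul1 p I (\<psi>l l)" "\<And>l. bessel_seq_dual smul2 q I (\<phi>l l)"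
    and "1 \<le> p1" "1 \<le> q1" "1 / p1 + 1 / q1 = 1"
  shows
    "(converges_in_ell p1 I ml m \<longrightarrow>
       (\<lambda>l. onorm (\<lambda>f. multiplier smul2 I (ml l) \<phi> \<psi> f - multiplier smul2 I m \<phi> \<psi> f))
         \<longlonglongrightarrow> 0) \<and>
     (in_ell p1 I m \<and> converges_in_ell_sense q1 I \<psi>l \<psi> \<longrightarrow>
       (\<lambda>l. onorm (\<lambda>f. multiplier smul2 I m \<phi> (\<psi>l l) f - multiplier smul2 I m \<phi> \<psi> f))
         \<longlonglongrightarrow> 0) \<and>
     (in_ell p1 I m \<and> converges_in_ell_sense q1 I \<phi>l \<phi> \<longrightarrow>
       (\<lambda>l. onorm (\<lambda>f. multiplier smul2 I m (\<phi>l l) \<psi> f - multiplier smul2 I m \<phi> \<psi> f))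
         \<longlonglongrightarrow> 0) \<and>
     (converges_in_ell p1 I ml m \<and> converges_in_ell_sense q1 I \<psi>l \<psi> \<and>
        converges_in_ell_sense q1 I \<phi>l \<phi> \<longrightarrow>
       (\<lambda>l. onorm (\<lambda>f. multiplier smul2 I (ml l) (\<phi>l l) (\<psi>l l) f - multiplier smul2 I m \<phi> \<psi> f))
         \<longlonglongrightarrow> 0)"
proof -
  interpret X2: banach_over smul2 by fact
  have "0 < 1 / p" "0 < 1 / q" using \<open>p > 0\<close> \<open>q > 0\<close> by simp_all
  then have "1 / p < 1" "1 / q < 1" using \<open>1 / p + 1 / q = 1\<close> by linarith+
  then have pq: "1 < p" "1 < q" using \<open>p > 0\<close> \<open>q > 0\<close> by (simp_all add: field_simps)
  obtain B1 where B1: "analysis_bound p I \<psi> B1"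
    using bessel_seq_analysis_bound \<open>bessel_seq smul1 p I \<psi>\<close> .
  obtain B2 where B2: "synthesis_bound smul2 q I \<phi> B2"
    using bessel_seq_dual_synthesis_bound \<open>bessel_seq_dual smul2 q I \<phi>\<close> .
  note lim = X2.onorm_multiplier_diff_tendsto_zero[OF pq \<open>1 / p + 1 / q = 1\<close>
      \<open>1 \<le> p1\<close> \<open>1 \<le> q1\<close> \<open>1 / p1 + 1 / q1 = 1\<close> B1 B2]
  show ?thesis
    by (intro conjI impI; (elim conjE)?; intro lim)
      (assumption | rule converges_in_ell_const converges_in_ell_sense_const)+
qed

end
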